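(* Let $h$ be a Hessenberg function with degree tuple $\beta$. The generating set $\mathcal{J}_h=\{\tilde e_{\beta_n}(n),\tilde e_{\beta_{n-1}}(n-1,n),\ldots,\tilde e_{\beta_1}(1,\ldots,n)\}$ is a Gröbner basis for the ideal $J_h$ of $\mathbb{Z}[x_1,\ldots,x_n]$ with respect to the lexicographic or the graded lexicographic monomial order.
   Context: A Hessenberg function is an $n$-tuple $h=(h_1,\ldots,h_n)$ of integers with $i\le h_i\le n$ and $h_i\le h_{i+1}$. Its degree tuple is $\beta=(\beta_n,\ldots,\beta_1)$ with $\beta_i=i-\#\{k:h_k<i\}$. For $S\subseteq\{1,\ldots,n\}$, $\tilde e_d(S)$ is the sum of all monomials (not necessarily squarefree) of degree $d$ in the variables $x_i$, $i\in S$, and $\tilde e_d(i,\ldots,n)$ means $S=\{i,\ldots,n\}$. $J_h$ is the ideal generated by $\mathcal{J}_h$. Lexicographic order: $x^\alpha>x^\gamma$ if the leftmost nonzero entry of $\alpha-\gamma$ is positive (so $x_1>x_2>\cdots>x_n$); graded lex compares total degree first and then lex. A set $G=\{g_1,\ldots,g_t\}$ is a Gröbner basis of an ideal $I$ if the ideal generated by leading terms of all elements of $I$ equals $\langle LT(g_1),\ldots,LT(g_t)\rangle$. *)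

theory Defs
  imports "HOL-Algebra.Ideal" "HOL-Library.Poly_Mapping"
begin

text \<open>
  A monomial \<open>x\<^sup>\<alpha>\<close> is represented by its exponent vector, a finitely supported function from
  variable indices to exponents; a polynomial is a finitely supported function from monomials
  to integer coefficients.  Variables are indexed from 1.
\<close>

type_synonym monomial = "nat \<Rightarrow>\<^sub>0 nat"
type_synonym mpoly_int = "monomial \<Rightarrow>\<^sub>0 int"

definition int_mpoly_ring :: "nat \<Rightarrow> mpoly_int ring" where
  "int_mpoly_ring n =
     \<lparr>carrier = {f. \<forall>m \<in> Poly_Mapping.keys f. Poly_Mapping.keys m \<subseteq> {1..n}},
      mult = (*), one = 1, zero = 0, add = (+)\<rparr>"

definition total_degree :: "monomial \<Rightarrow> nat" where
  "total_degree m = (\<Sum>i \<in> Poly_Mapping.keys m. Poly_Mapping.lookup m i)"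

text \<open>
  Monomial orders are given by their strict part.  Reading positions from left to right is reading
  indices in increasing order, so that \<open>x\<^sub>1 > x\<^sub>2 > \<dots> > x\<^sub>n\<close>; index 0 plays no role for monomials
  in \<open>x\<^sub>1, \<dots>, x\<^sub>n\<close>.
\<close>

definition lex_less :: "monomial \<Rightarrow> monomial \<Rightarrow> bool" where
  "lex_less \<gamma> \<alpha> \<longleftrightarrow>
     (\<exists>i. Poly_Mapping.lookup \<gamma> i < Poly_Mapping.lookup \<alpha> i \<and>
          (\<forall>j < i. Poly_Mapping.lookup \<alpha> j = Poly_Mapping.lookup \<gamma> j))"

definition grlex_less :: "monomial \<Rightarrow> monomial \<Rightarrow> bool" where
  "grlex_less \<gamma> \<alpha> \<longleftrightarrow>
     total_degree \<gamma> < total_degree \<alpha> \<or>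
     total_degree \<gamma> = total_degree \<alpha> \<and> lex_less \<gamma> \<alpha>"

definition leading_monomial :: "(monomial \<Rightarrow> monomial \<Rightarrow> bool) \<Rightarrow> mpoly_int \<Rightarrow> monomial" where
  "leading_monomial lt f =
     (THE m. m \<in> Poly_Mapping.keys f \<and> (\<forall>m' \<in> Poly_Mapping.keys f. m' \<noteq> m \<longrightarrow> lt m' m))"

text \<open>Over the integers the leading term has to include its coefficient.\<close>

definition leading_term :: "(monomial \<Rightarrow> monomial \<Rightarrow> bool) \<Rightarrow> mpoly_int \<Rightarrow> mpoly_int" where
  "leading_term lt f =
     (if f = 0 then 0
      else Poly_Mapping.single (leading_monomial lt f)
             (Poly_Mapping.lookup f (leading_monomial lt f)))"

definition groebner_basis ::
  "nat \<Rightarrow> (monomial \<Rightarrow> monomial \<Rightarrow> bool) \<Rightarrow> mpoly_int set \<Rightarrow> mpoly_int set \<Rightarrow> bool" where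
  "groebner_basis n lt G I \<longleftrightarrow>
     ideal I (int_mpoly_ring n) \<and> finite G \<and> G \<subseteq> I \<and>
     genideal (int_mpoly_ring n) (leading_term lt ` I) =
     genideal (int_mpoly_ring n) (leading_term lt ` G)"

text \<open>Only the values \<open>h 1, \<dots>, h n\<close> are relevant.\<close>

definition hessenberg :: "nat \<Rightarrow> (nat \<Rightarrow> nat) \<Rightarrow> bool" where
  "hessenberg n h \<longleftrightarrow>
     (\<forall>i \<in> {1..n}. i \<le> h i \<and> h i \<le> n) \<and> (\<forall>i \<in> {1..<n}. h i \<le> h (i + 1))"

text \<open>
  For a Hessenberg function, \<open>h k < i\<close> implies \<open>k < i\<close>, so the subtraction does not truncate
  (the value is at least 1 for \<open>i \<ge> 1\<close>).
\<close>

definition degree_tuple :: "nat \<Rightarrow> (nat \<Rightarrow> nat) \<Rightarrow> nat \<Rightarrow> nat" where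
  "degree_tuple n h i = i - card {k \<in> {1..n}. h k < i}"

text \<open>The complete homogeneous sum; meant for finite \<open>S\<close>.\<close>

definition e_tilde :: "nat \<Rightarrow> nat set \<Rightarrow> mpoly_int" where
  "e_tilde d S =
    (\<Sum>m \<in> {m. Poly_Mapping.keys m \<subseteq> S \<and> total_degree m = d}.
     Poly_Mapping.single m 1)"

definition J_generators :: "nat \<Rightarrow> (nat \<Rightarrow> nat) \<Rightarrow> mpoly_int set" where
  "J_generators n h = {e_tilde (degree_tuple n h i) {i..n} | i. i \<in> {1..n}}"

definition J_ideal :: "nat \<Rightarrow> (nat \<Rightarrow> nat) \<Rightarrow> mpoly_int set" where
  "J_ideal n h = genideal (int_mpoly_ring n) (J_generators n h)"

end

theory Submission
  imports Defs "HOL.Modules"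
begin

text \<open>
  In every monomial order with \<open>x\<^sub>1 > \<dots> > x\<^sub>n\<close> the polynomial \<open>e_tilde d {i..n}\<close> is monic with
  leading monomial \<open>x\<^sub>i\<^sup>d\<close>, and monic polynomials with pairwise coprime leading monomials form a
  Groebner basis.  For the latter, induct on the set of generators: an element of \<open>\<langle>G, g\<rangle>\<close> is of the
  form \<open>p + r * g\<close> with \<open>p \<in> \<langle>G\<rangle>\<close> and \<open>r\<close> reduced modulo \<open>G\<close>.  By coprimality no leading monomial
  of \<open>G\<close> divides the leading monomial of \<open>r * g\<close>, whereas one of them divides that of \<open>p\<close>.  Hence the
  two differ, and the larger one is the leading monomial of the sum.
\<close>

section \<open>Exponent vectors and indeterminates\<close>

definition monomial_dvd :: "monomial \<Rightarrow> monomial \<Rightarrow> bool" where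
  "monomial_dvd a m \<longleftrightarrow> (\<forall>i. Poly_Mapping.lookup a i \<le> Poly_Mapping.lookup m i)"

lemma monomial_diff_add_cancel: "monomial_dvd a m \<Longrightarrow> (m - a) + a = m"
  by (rule poly_mapping_eqI) (simp add: monomial_dvd_def lookup_add lookup_minus)

lemma monomial_dvd_add_right: "monomial_dvd a (m + a)"
  by (simp add: monomial_dvd_def lookup_add)

definition monomial_coprime :: "monomial \<Rightarrow> monomial \<Rightarrow> bool" where
  "monomial_coprime a b \<longleftrightarrow> disjnt (Poly_Mapping.keys a) (Poly_Mapping.keys b)"

lemma monomial_dvd_add_coprime:
  assumes "monomial_coprime a b" "monomial_dvd a (m + b)"
  shows "monomial_dvd a m"
  unfolding monomial_dvd_def
proof
  fix i
  have "Poly_Mapping.lookup a i \<le> Poly_Mapping.lookup m i + Poly_Mapping.lookup b i"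
    using assms(2) by (simp add: monomial_dvd_def lookup_add)
  moreover have "Poly_Mapping.lookup a i = 0 \<or> Poly_Mapping.lookup b i = 0"
    using assms(1) by (auto simp: monomial_coprime_def disjnt_iff in_keys_iff)
  ultimately show "Poly_Mapping.lookup a i \<le> Poly_Mapping.lookup m i" by auto
qed

lemma keys_monomial_diff: "Poly_Mapping.keys (m - a :: monomial) \<subseteq> Poly_Mapping.keys m"
  by (auto simp: in_keys_iff lookup_minus)

definition indets :: "mpoly_int \<Rightarrow> nat set" where
  "indets f = (\<Union>m\<in>Poly_Mapping.keys f. Poly_Mapping.keys m)"

lemma finite_indets: "finite (indets f)"
  by (simp add: indets_def)

lemma indets_zero [simp]: "indets 0 = {}" and indets_one [simp]: "indets 1 = {}"
  by (simp_all add: indets_def)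

lemma indets_uminus [simp]: "indets (- f) = indets f"
  by (simp add: indets_def)

lemma indets_single: "indets (Poly_Mapping.single m c) \<subseteq> Poly_Mapping.keys m"
  by (simp add: indets_def)

lemma indets_add: "indets (f + g) \<subseteq> indets f \<union> indets g"
  using keys_add[of f g] by (auto simp: indets_def)

lemma indets_diff: "indets (f - g) \<subseteq> indets f \<union> indets g"
  using keys_diff[of f g] by (auto simp: indets_def)

lemma indets_mult: "indets (f * g) \<subseteq> indets f \<union> indets g"
proof
  fix i assume "i \<in> indets (f * g)"
  then obtain u v where "u \<in> Poly_Mapping.keys f" "v \<in> Poly_Mapping.keys g"
      "i \<in> Poly_Mapping.keys (u + v)"
    using keys_mult[of f g] by (auto simp: indets_def)
  then show "i \<in> indets f \<union> indets g"
    using keys_add[of u v] by (auto simp: indets_def)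
qed

text \<open>Ideals are submodules of the regular module, so \<open>regular.span G\<close> is the ideal \<open>\<langle>G\<rangle>\<close>.\<close>

interpretation regular: module "(*) :: 'a::comm_ring_1 \<Rightarrow> 'a \<Rightarrow> 'a"
  by unfold_locales (simp_all add: algebra_simps)

section \<open>Leading monomials\<close>

locale monomial_order =
  fixes less :: "monomial \<Rightarrow> monomial \<Rightarrow> bool"  (infix \<open>\<prec>\<close> 50)
  assumes transp_less: "transp (\<prec>)"
    and totalp_less: "totalp (\<prec>)"
    and add_strict_right_mono: "a \<prec> b \<Longrightarrow> a + c \<prec> b + c"
    \<comment> \<open>Lex is not well-founded on monomials in infinitely many variables.\<close>
    and wfp_on_less: "finite S \<Longrightarrow> wfp_on {m. Poly_Mapping.keys m \<subseteq> S} (\<prec>)"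
begin

abbreviation less_eq :: "monomial \<Rightarrow> monomial \<Rightarrow> bool"  (infix \<open>\<preceq>\<close> 50) where
  "a \<preceq> b \<equiv> a = b \<or> a \<prec> b"

abbreviation lm :: "mpoly_int \<Rightarrow> monomial" where
  "lm \<equiv> leading_monomial (\<prec>)"

definition lc :: "mpoly_int \<Rightarrow> int" where
  "lc f = Poly_Mapping.lookup f (lm f)"

abbreviation monic :: "mpoly_int \<Rightarrow> bool" where
  "monic f \<equiv> lc f = 1"

lemma less_irrefl: "\<not> a \<prec> a"
  using wfp_on_less[OF finite_keys[of a]] unfolding wfp_on_iff_ex_minimal
  by (elim allE[of _ "{a}"]) auto

lemma less_trans: "a \<prec> b \<Longrightarrow> b \<prec> c \<Longrightarrow> a \<prec> c"
  using transp_less by (rule transpD)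

lemma less_linear: "a \<noteq> b \<Longrightarrow> a \<prec> b \<or> b \<prec> a"
  using totalp_less by (rule totalpD)

lemma add_strict_left_mono: "a \<prec> b \<Longrightarrow> c + a \<prec> c + b"
  using add_strict_right_mono[of a b c] by (simp add: add.commute)

lemma add_less_le_mono: "a \<prec> b \<Longrightarrow> c \<preceq> d \<Longrightarrow> a + c \<prec> b + d"
  by (metis add_strict_left_mono add_strict_right_mono less_trans)

lemma add_mono: "a \<preceq> b \<Longrightarrow> c \<preceq> d \<Longrightarrow> a + c \<preceq> b + d"
  by (metis add_less_le_mono add_strict_left_mono)

lemma leading_monomial_eqI:
  assumes "m \<in> Poly_Mapping.keys f" "\<And>u. u \<in> Poly_Mapping.keys f \<Longrightarrow> u \<preceq> m"
  shows "lm f = m"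
  unfolding leading_monomial_def using assms
  by (intro the_equality) (metis less_irrefl less_trans)+

lemma
  assumes "f \<noteq> 0"
  shows leading_monomial_in_keys: "lm f \<in> Poly_Mapping.keys f"
    and in_keys_le_leading_monomial: "u \<in> Poly_Mapping.keys f \<Longrightarrow> u \<preceq> lm f"
proof -
  obtain m where m: "m \<in> Poly_Mapping.keys f" "\<And>u. u \<in> Poly_Mapping.keys f \<Longrightarrow> u \<preceq> m"
    using Finite_Set.bex_greatest_element[of "Poly_Mapping.keys f" "(\<prec>)"] assms
      transp_on_subset[OF transp_less] totalp_on_subset[OF totalp_less] by auto
  then have "lm f = m" by (rule leading_monomial_eqI)
  with m show "lm f \<in> Poly_Mapping.keys f" "u \<in> Poly_Mapping.keys f \<Longrightarrow> u \<preceq> lm f" by auto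
qed

lemma lc_eq_0_iff: "lc f = 0 \<longleftrightarrow> f = 0"
  using leading_monomial_in_keys[of f] by (auto simp: lc_def in_keys_iff)

lemma monic_imp_nonzero: "monic f \<Longrightarrow> f \<noteq> 0"
  using lc_eq_0_iff[of f] by auto

lemma leading_term_eq: "f \<noteq> 0 \<Longrightarrow> leading_term (\<prec>) f = Poly_Mapping.single (lm f) (lc f)"
  by (simp add: leading_term_def lc_def)

lemma leading_monomial_single: "c \<noteq> 0 \<Longrightarrow> lm (Poly_Mapping.single m c) = m"
  by (rule leading_monomial_eqI) auto

lemma lc_single: "lc (Poly_Mapping.single m c) = c"
  by (cases "c = 0") (simp_all add: lc_def leading_monomial_single)

lemma keys_leading_monomial_subset_indets: "f \<noteq> 0 \<Longrightarrow> Poly_Mapping.keys (lm f) \<subseteq> indets f"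
  using leading_monomial_in_keys by (auto simp: indets_def)

lemma leading_monomial_add_less:
  assumes "f \<noteq> 0" "g \<noteq> 0" "lm f \<prec> lm g"
  shows "lm (f + g) = lm g"
proof (rule leading_monomial_eqI)
  have "lm g \<notin> Poly_Mapping.keys f"
    using in_keys_le_leading_monomial[OF assms(1)] assms(3) less_irrefl less_trans by metis
  then show "lm g \<in> Poly_Mapping.keys (f + g)"
    using leading_monomial_in_keys[OF assms(2)] by (simp add: in_keys_iff lookup_add)
next
  fix u assume "u \<in> Poly_Mapping.keys (f + g)"
  then have "u \<preceq> lm f \<or> u \<preceq> lm g"
    using keys_add[of f g] in_keys_le_leading_monomial assms(1,2) by blast
  then show "u \<preceq> lm g" using assms(3) less_trans by blast
qed

lemma leading_monomial_add:
  assumes "f \<noteq> 0" "g \<noteq> 0" "lm f \<noteq> lm g"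
  shows "lm (f + g) \<in> {lm f, lm g}"
  using less_linear[OF assms(3)] leading_monomial_add_less[of f g]
    leading_monomial_add_less[of g f] assms(1,2) by (auto simp: add.commute)

lemma leading_monomial_diff_less:
  assumes "f \<noteq> 0" "h \<noteq> 0" "f \<noteq> h" "lm h = lm f" "lc h = lc f"
  shows "lm (f - h) \<prec> lm f"
proof -
  have lm_in_keys: "lm (f - h) \<in> Poly_Mapping.keys (f - h)"
    using assms(3) by (intro leading_monomial_in_keys) simp
  then have "lm (f - h) \<preceq> lm f"
    using keys_diff[of f h] assms(1,2,4) in_keys_le_leading_monomial[of f]
      in_keys_le_leading_monomial[of h] by auto
  moreover have "lm f \<notin> Poly_Mapping.keys (f - h)"
    using assms(4,5) by (simp add: in_keys_iff lookup_minus lc_def)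
  ultimately show ?thesis using lm_in_keys by auto
qed

lemma lookup_mult_leading_monomials:
  assumes "f \<noteq> 0" "g \<noteq> 0"
  shows "Poly_Mapping.lookup (f * g) (lm f + lm g) = lc f * lc g"
proof -
  let ?S = "\<lambda>u. \<Sum>v. Poly_Mapping.lookup g v when lm f + lm g = u + v"
  have "Poly_Mapping.lookup f u * ?S u = (lc f * lc g when u = lm f)" for u
  proof (cases "u \<in> Poly_Mapping.keys f \<and> u \<noteq> lm f")
    case True
    then have "u \<prec> lm f" using in_keys_le_leading_monomial[OF assms(1)] by blast
    then have "u + v \<prec> lm f + lm g" if "v \<in> Poly_Mapping.keys g" for v
      using that in_keys_le_leading_monomial[OF assms(2)] by (intro add_less_le_mono)
    then have "lm f + lm g \<noteq> u + v" if "v \<in> Poly_Mapping.keys g" for v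
      using that less_irrefl by metis
    then have "(Poly_Mapping.lookup g v when lm f + lm g = u + v) = 0" for v
      by (auto simp: when_def in_keys_iff)
    then show ?thesis using True by simp
  qed (auto simp: in_keys_iff lc_def when_def)
  then show ?thesis by (simp add: lookup_mult)
qed

lemma leading_monomial_mult:
  assumes "f \<noteq> 0" "g \<noteq> 0"
  shows "lm (f * g) = lm f + lm g"
proof (rule leading_monomial_eqI)
  show "lm f + lm g \<in> Poly_Mapping.keys (f * g)"
    using assms by (simp add: in_keys_iff lookup_mult_leading_monomials lc_eq_0_iff)
next
  fix m assume "m \<in> Poly_Mapping.keys (f * g)"
  then obtain u v where "m = u + v" "u \<in> Poly_Mapping.keys f" "v \<in> Poly_Mapping.keys g"
    using keys_mult[of f g] by blast
  then show "m \<preceq> lm f + lm g"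
    using add_mono[OF in_keys_le_leading_monomial in_keys_le_leading_monomial] assms by simp
qed

lemma lc_mult: "f \<noteq> 0 \<Longrightarrow> g \<noteq> 0 \<Longrightarrow> lc (f * g) = lc f * lc g"
  by (simp add: lc_def[of "f * g"] leading_monomial_mult lookup_mult_leading_monomials)

section \<open>Division and the coprime leading monomial criterion\<close>

definition reduced :: "mpoly_int set \<Rightarrow> mpoly_int \<Rightarrow> bool" where
  "reduced G r \<longleftrightarrow> (\<forall>m\<in>Poly_Mapping.keys r. \<forall>g\<in>G. \<not> monomial_dvd (lm g) m)"

lemma reduced_zero: "reduced G 0"
  by (simp add: reduced_def)

lemma reduced_add: "reduced G r \<Longrightarrow> reduced G s \<Longrightarrow> reduced G (r + s)"
  using keys_add[of r s] by (auto simp: reduced_def)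

lemma ex_same_leading_term_with_remainder:
  assumes "\<And>g. g \<in> G \<Longrightarrow> monic g" "\<And>g. g \<in> G \<Longrightarrow> indets g \<subseteq> S" "f \<noteq> 0" "indets f \<subseteq> S"
  obtains h r where "h \<noteq> 0" "lm h = lm f" "lc h = lc f" "indets h \<subseteq> S"
    "h - r \<in> regular.span G" "reduced G r"
proof -
  have lc_nonzero: "lc f \<noteq> 0" using assms(3) by (simp add: lc_eq_0_iff)
  have keys_lm: "Poly_Mapping.keys (lm f) \<subseteq> S"
    using keys_leading_monomial_subset_indets assms(3,4) by blast
  show thesis
  proof (cases "\<exists>g\<in>G. monomial_dvd (lm g) (lm f)")
    case True
    then obtain g where g: "g \<in> G" "monomial_dvd (lm g) (lm f)" by blast
    let ?q = "Poly_Mapping.single (lm f - lm g) (lc f)"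
    have nonzero: "?q \<noteq> 0" "g \<noteq> 0"
      using lc_nonzero lc_eq_0_iff[of ?q] assms(1) monic_imp_nonzero g(1) by (auto simp: lc_single)
    have "indets ?q \<subseteq> S" using indets_single keys_monomial_diff keys_lm by blast
    then have "indets (?q * g) \<subseteq> S" using indets_mult assms(2)[OF g(1)] by blast
    then show thesis
      using lc_nonzero nonzero g assms(1)[OF g(1)]
      by (intro that[of "?q * g" 0])
        (simp_all add: leading_monomial_mult lc_mult lc_single leading_monomial_single
          monomial_diff_add_cancel reduced_zero regular.span_base regular.span_scale)
  next
    case False
    let ?h = "Poly_Mapping.single (lm f) (lc f)"
    show thesis
    proof (rule that[of ?h ?h])
      show "?h \<noteq> 0" using lc_nonzero lc_eq_0_iff[of ?h] by (simp add: lc_single)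
      show "indets ?h \<subseteq> S" using indets_single keys_lm by blast
      show "reduced G ?h" using False by (simp add: reduced_def)
    qed (simp_all add: lc_nonzero leading_monomial_single lc_single regular.span_zero)
  qed
qed

lemma ex_division_step:
  assumes "\<And>g. g \<in> G \<Longrightarrow> monic g" "\<And>g. g \<in> G \<Longrightarrow> indets g \<subseteq> S" "f \<noteq> 0" "indets f \<subseteq> S"
  obtains f' r where "f' = 0 \<or> lm f' \<prec> lm f" "indets f' \<subseteq> S"
    "(f - f') - r \<in> regular.span G" "reduced G r"
proof -
  obtain h r where h: "h \<noteq> 0" "lm h = lm f" "lc h = lc f" "indets h \<subseteq> S"
    and r: "h - r \<in> regular.span G" "reduced G r"
    by (rule ex_same_leading_term_with_remainder[OF assms])
  show thesis
  proof (rule that[of "f - h" r])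
    show "f - h = 0 \<or> lm (f - h) \<prec> lm f"
      using leading_monomial_diff_less[OF assms(3) h(1) _ h(2,3)] by auto
    show "indets (f - h) \<subseteq> S" using indets_diff h(4) assms(4) by blast
  qed (use r in simp_all)
qed

theorem ex_reduced_remainder:
  assumes "finite G" and monic_G: "\<And>g. g \<in> G \<Longrightarrow> monic g"
  shows "\<exists>r. f - r \<in> regular.span G \<and> reduced G r"
proof (cases "f = 0")
  case True
  then show ?thesis by (intro exI[of _ 0]) (simp add: reduced_zero regular.span_zero)
next
  case False
  define S where "S = \<Union> (indets ` insert f G)"
  have finite_S: "finite S" and S_G: "\<And>g. g \<in> G \<Longrightarrow> indets g \<subseteq> S" and S_f: "indets f \<subseteq> S"
    using assms(1) finite_indets by (auto simp: S_def)
  then have "lm f \<in> {m. Poly_Mapping.keys m \<subseteq> S}"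
    using keys_leading_monomial_subset_indets[OF False] by auto
  from wfp_on_less[OF finite_S] this False S_f show ?thesis
  proof (induction "lm f" arbitrary: f rule: wfp_on_induct[consumes 2, case_names less])
    case (less f)
    obtain f' s where f': "f' = 0 \<or> lm f' \<prec> lm f" "indets f' \<subseteq> S"
      and s: "(f - f') - s \<in> regular.span G" "reduced G s"
      by (rule ex_division_step[OF monic_G S_G less.prems])
    obtain r where r: "f' - r \<in> regular.span G" "reduced G r"
    proof (cases "f' = 0")
      case True
      then show thesis using that[of 0] by (simp add: reduced_zero regular.span_zero)
    next
      case False
      then have "Poly_Mapping.keys (lm f') \<subseteq> S"
        using keys_leading_monomial_subset_indets f'(2) by blast
      then show thesis using less.hyps(2)[of f'] False f' that by auto
    qed
    have "f - (r + s) \<in> regular.span G"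
      using regular.span_add[OF r(1) s(1)] by (simp add: algebra_simps)
    then show ?case using reduced_add[OF r(2) s(2)] by blast
  qed
qed

lemma not_monomial_dvd_leading_monomial_reduced_mult:
  assumes "reduced G r" "r \<noteq> 0" "g \<noteq> 0" "g' \<in> G"
    and "monomial_coprime (lm g') (lm g)"
  shows "\<not> monomial_dvd (lm g') (lm (r * g))"
proof
  assume "monomial_dvd (lm g') (lm (r * g))"
  then have "monomial_dvd (lm g') (lm r)"
    using monomial_dvd_add_coprime[OF assms(5)] by (simp add: leading_monomial_mult assms)
  then show False
    using assms(1,4) leading_monomial_in_keys[OF assms(2)] by (auto simp: reduced_def)
qed

theorem leading_monomial_dvd_if_coprime:
  assumes "finite G" "\<And>g. g \<in> G \<Longrightarrow> monic g"
    and "pairwise (\<lambda>g g'. monomial_coprime (lm g) (lm g')) G"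
    and "f \<in> regular.span G" "f \<noteq> 0"
  shows "\<exists>g\<in>G. monomial_dvd (lm g) (lm f)"
  using assms
proof (induction G arbitrary: f rule: finite_induct)
  case empty
  then show ?case by simp
next
  case (insert g G)
  obtain q where f_mod_g: "f - q * g \<in> regular.span G"
    using insert.prems(3) by (auto simp: regular.span_breakdown_eq)
  obtain r where r: "q - r \<in> regular.span G" "reduced G r"
    using ex_reduced_remainder[OF insert.hyps(1)] insert.prems(1) by blast
  define p where "p = f - r * g"
  have "p = (f - q * g) + g * (q - r)" by (simp add: p_def algebra_simps)
  then have p_in_span: "p \<in> regular.span G"
    using regular.span_add[OF f_mod_g regular.span_scale[OF r(1)]] by simp
  have f_eq: "f = p + r * g" by (simp add: p_def)
  have g_nonzero: "g \<noteq> 0" using insert.prems(1) monic_imp_nonzero by simp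
  have dvd_p: "\<exists>g'\<in>G. monomial_dvd (lm g') (lm p)" if "p \<noteq> 0"
    using insert.IH[OF _ _ p_in_span that] insert.prems(1,2) by (simp add: pairwise_insert)
  have dvd_rg: "monomial_dvd (lm g) (lm (r * g))" if "r \<noteq> 0"
    using that g_nonzero by (simp add: leading_monomial_mult monomial_dvd_add_right)
  show ?case
  proof (cases "p = 0 \<or> r = 0")
    case True
    then show ?thesis using f_eq dvd_p dvd_rg insert.prems(4) by auto
  next
    case False
    have "\<not> monomial_dvd (lm g') (lm (r * g))" if "g' \<in> G" for g'
      using that False g_nonzero insert.prems(2) insert.hyps(2)
      by (intro not_monomial_dvd_leading_monomial_reduced_mult[OF r(2)])
        (auto simp: pairwise_insert)
    then have "lm p \<noteq> lm (r * g)" using dvd_p False by auto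
    then have "lm f \<in> {lm p, lm (r * g)}"
      unfolding f_eq using False g_nonzero by (intro leading_monomial_add) auto
    then show ?thesis using dvd_p dvd_rg False by auto
  qed
qed

end

section \<open>Ideals of the polynomial ring\<close>

lemma carrier_int_mpoly_ring: "carrier (int_mpoly_ring n) = {f. indets f \<subseteq> {1..n}}"
  by (auto simp: int_mpoly_ring_def indets_def)

lemma int_mpoly_ring_simps [simp]:
  "mult (int_mpoly_ring n) = (*)" "one (int_mpoly_ring n) = 1"
  "zero (int_mpoly_ring n) = 0" "add (int_mpoly_ring n) = (+)"
  by (simp_all add: int_mpoly_ring_def)

lemma int_mpoly_ring_closed:
  assumes "f \<in> carrier (int_mpoly_ring n)" "g \<in> carrier (int_mpoly_ring n)"
  shows "f + g \<in> carrier (int_mpoly_ring n)" "f * g \<in> carrier (int_mpoly_ring n)"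
  using assms indets_add[of f g] indets_mult[of f g] by (auto simp: carrier_int_mpoly_ring)

lemma cring_int_mpoly_ring: "cring (int_mpoly_ring n)"
proof (rule cringI)
  show "abelian_group (int_mpoly_ring n)"
  proof (rule abelian_groupI)
    fix f assume "f \<in> carrier (int_mpoly_ring n)"
    then show "\<exists>g\<in>carrier (int_mpoly_ring n).
        g \<oplus>\<^bsub>int_mpoly_ring n\<^esub> f = \<zero>\<^bsub>int_mpoly_ring n\<^esub>"
      by (intro bexI[of _ "- f"]) (auto simp: carrier_int_mpoly_ring)
  qed (simp_all add: int_mpoly_ring_closed, simp_all add: carrier_int_mpoly_ring algebra_simps)
  show "Group.comm_monoid (int_mpoly_ring n)"
    by (rule comm_monoidI)
      (simp_all add: int_mpoly_ring_closed, simp_all add: carrier_int_mpoly_ring algebra_simps)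
qed (simp add: algebra_simps)

lemma a_inv_int_mpoly_ring:
  assumes "f \<in> carrier (int_mpoly_ring n)"
  shows "\<ominus>\<^bsub>int_mpoly_ring n\<^esub> f = - f"
proof -
  interpret cring "int_mpoly_ring n" by (rule cring_int_mpoly_ring)
  show ?thesis
    using assms by (intro minus_equality) (auto simp: carrier_int_mpoly_ring)
qed

lemma ideal_carrier_Int_span:
  "ideal (carrier (int_mpoly_ring n) \<inter> regular.span G) (int_mpoly_ring n)"  (is "ideal ?I ?R")
proof -
  interpret cring ?R by (rule cring_int_mpoly_ring)
  show ?thesis
  proof (rule idealI)
    show "subgroup ?I (add_monoid ?R)"
    proof (rule add.subgroupI)
      fix f assume "f \<in> ?I"
      then show "\<ominus>\<^bsub>?R\<^esub> f \<in> ?I"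
        using regular.span_neg by (auto simp: a_inv_int_mpoly_ring carrier_int_mpoly_ring)
    next
      show "?I \<noteq> {}" using regular.span_zero[of G] zero_closed by auto
    qed (auto simp: int_mpoly_ring_closed regular.span_add)
  next
    fix f g assume "f \<in> ?I" "g \<in> carrier ?R"
    then have "g * f \<in> ?I" by (simp add: int_mpoly_ring_closed regular.span_scale)
    then show "g \<otimes>\<^bsub>?R\<^esub> f \<in> ?I" "f \<otimes>\<^bsub>?R\<^esub> g \<in> ?I" by (simp_all add: mult.commute)
  qed (rule ring_axioms)
qed

lemma genideal_subset_span:
  assumes "G \<subseteq> carrier (int_mpoly_ring n)"
  shows "genideal (int_mpoly_ring n) G \<subseteq> carrier (int_mpoly_ring n) \<inter> regular.span G"
proof -
  interpret cring "int_mpoly_ring n" by (rule cring_int_mpoly_ring)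
  show ?thesis
    using assms regular.span_superset by (intro genideal_minimal ideal_carrier_Int_span) blast
qed

context monomial_order
begin

lemma leading_term_closed:
  assumes "f \<in> carrier (int_mpoly_ring n)"
  shows "leading_term (\<prec>) f \<in> carrier (int_mpoly_ring n)"
proof (cases "f = 0")
  case True
  then show ?thesis by (simp add: leading_term_def carrier_int_mpoly_ring)
next
  case False
  then show ?thesis
    using assms keys_leading_monomial_subset_indets[OF False] indets_single[of "lm f" "lc f"]
    by (simp add: leading_term_eq carrier_int_mpoly_ring)
qed

lemma leading_term_eq_mult:
  assumes "f \<noteq> 0" "monic g" "monomial_dvd (lm g) (lm f)"
  shows "leading_term (\<prec>) f = Poly_Mapping.single (lm f - lm g) (lc f) * leading_term (\<prec>) g"
  using assms monic_imp_nonzero[OF assms(2)]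
  by (simp add: leading_term_eq mult_single monomial_diff_add_cancel)

lemma groebner_basisI:
  assumes G: "finite G" "G \<subseteq> carrier (int_mpoly_ring n)" "\<And>g. g \<in> G \<Longrightarrow> monic g"
    and dvd: "\<And>f. f \<in> genideal (int_mpoly_ring n) G \<Longrightarrow> f \<noteq> 0 \<Longrightarrow>
      \<exists>g\<in>G. monomial_dvd (lm g) (lm f)"
  shows "groebner_basis n (\<prec>) G (genideal (int_mpoly_ring n) G)"
proof -
  let ?R = "int_mpoly_ring n" and ?lt = "leading_term (\<prec>)"
  interpret cring ?R by (rule cring_int_mpoly_ring)
  let ?I = "Idl\<^bsub>?R\<^esub> G" and ?L = "Idl\<^bsub>?R\<^esub> (?lt ` G)"
  have ideal_I: "ideal ?I ?R" and G_subset_I: "G \<subseteq> ?I"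
    using G(2) by (rule genideal_ideal, rule genideal_self)
  have I_subset_R: "?I \<subseteq> carrier ?R" using ideal_I by (auto intro: ideal.Icarr)
  have leading_terms_subset_R: "?lt ` G \<subseteq> carrier ?R" "?lt ` ?I \<subseteq> carrier ?R"
    using G(2) I_subset_R leading_term_closed by blast+
  have ideal_L: "ideal ?L ?R" by (rule genideal_ideal[OF leading_terms_subset_R(1)])
  have "?lt f \<in> ?L" if f: "f \<in> ?I" for f
  proof (cases "f = 0")
    case True
    then show ?thesis
      using additive_subgroup.zero_closed[OF ideal.axioms(1)[OF ideal_L]]
      by (simp add: leading_term_def)
  next
    case False
    then obtain g where g: "g \<in> G" "monomial_dvd (lm g) (lm f)" using dvd f by blast
    have "?lt g \<in> ?L" using g(1) genideal_self[OF leading_terms_subset_R(1)] by blast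
    moreover have "Poly_Mapping.single (lm f - lm g) (lc f) \<in> carrier ?R"
      using indets_single keys_monomial_diff keys_leading_monomial_subset_indets[OF False]
        f I_subset_R
      by (fastforce simp: carrier_int_mpoly_ring)
    ultimately show ?thesis
      using ideal.I_l_closed[OF ideal_L]
      by (simp add: leading_term_eq_mult[OF False G(3) g(2)] g(1))
  qed
  then have "Idl\<^bsub>?R\<^esub> (?lt ` ?I) \<subseteq> ?L"
    by (intro genideal_minimal[OF ideal_L]) blast
  moreover have "?L \<subseteq> Idl\<^bsub>?R\<^esub> (?lt ` ?I)"
    using leading_terms_subset_R(2) G_subset_I by (intro subset_Idl_subset) blast+
  ultimately show ?thesis
    using ideal_I G(1) G_subset_I by (simp add: groebner_basis_def)
qed

theorem groebner_basis_if_coprime: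
  assumes "finite G" "G \<subseteq> carrier (int_mpoly_ring n)" "\<And>g. g \<in> G \<Longrightarrow> monic g"
    and "pairwise (\<lambda>g g'. monomial_coprime (lm g) (lm g')) G"
  shows "groebner_basis n (\<prec>) G (genideal (int_mpoly_ring n) G)"
  using assms genideal_subset_span[OF assms(2)]
  by (intro groebner_basisI leading_monomial_dvd_if_coprime) auto

end

section \<open>Complete homogeneous sums\<close>

lemma monomial_dvd_single_in_keys:
  "i \<in> Poly_Mapping.keys m \<Longrightarrow> monomial_dvd (Poly_Mapping.single i 1) m"
  by (auto simp: monomial_dvd_def lookup_single when_def in_keys_iff)

lemma total_degree_superset:
  assumes "finite S" "Poly_Mapping.keys m \<subseteq> S"
  shows "total_degree m = (\<Sum>i\<in>S. Poly_Mapping.lookup m i)"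
  unfolding total_degree_def
  by (rule sum.mono_neutral_left) (use assms in \<open>auto simp: in_keys_iff\<close>)

lemma total_degree_add: "total_degree (a + b) = total_degree a + total_degree b"
proof -
  let ?S = "Poly_Mapping.keys a \<union> Poly_Mapping.keys b"
  have "total_degree (a + b) = (\<Sum>i\<in>?S. Poly_Mapping.lookup (a + b) i)"
    by (intro total_degree_superset keys_add) simp
  also have "\<dots> = (\<Sum>i\<in>?S. Poly_Mapping.lookup a i) + (\<Sum>i\<in>?S. Poly_Mapping.lookup b i)"
    by (simp add: lookup_add sum.distrib)
  also have "\<dots> = total_degree a + total_degree b"
    by (simp add: total_degree_superset[of ?S])
  finally show ?thesis .
qed

lemma total_degree_single [simp]: "total_degree (Poly_Mapping.single i d) = d"
  by (simp add: total_degree_def)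

lemma lookup_le_total_degree: "Poly_Mapping.lookup m i \<le> total_degree m"
proof (cases "i \<in> Poly_Mapping.keys m")
  case True
  then show ?thesis unfolding total_degree_def by (intro member_le_sum) auto
qed (simp add: in_keys_iff)

lemma total_degree_eq_0_iff: "total_degree m = 0 \<longleftrightarrow> m = 0"
proof
  assume "total_degree m = 0"
  then have "Poly_Mapping.lookup m i = 0" for i
    using lookup_le_total_degree[of m i] by simp
  then show "m = 0" by (intro poly_mapping_eqI) simp
qed (simp add: total_degree_def)

definition monomials_of_degree :: "nat \<Rightarrow> nat set \<Rightarrow> monomial set" where
  "monomials_of_degree d S = {m. Poly_Mapping.keys m \<subseteq> S \<and> total_degree m = d}"

lemma finite_monomials_of_degree:
  assumes "finite S"
  shows "finite (monomials_of_degree d S)"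
proof -
  let ?F = "{f :: nat \<Rightarrow> nat. \<forall>x. (x \<in> S \<longrightarrow> f x \<in> {..d}) \<and> (x \<notin> S \<longrightarrow> f x = 0)}"
  have "finite ?F" by (rule finite_set_of_finite_funs) (use assms in auto)
  moreover have "Poly_Mapping.lookup ` monomials_of_degree d S \<subseteq> ?F"
    using lookup_le_total_degree by (auto simp: monomials_of_degree_def in_keys_iff)
  ultimately have "finite (Poly_Mapping.lookup ` monomials_of_degree d S)"
    by (rule rev_finite_subset)
  then show ?thesis
    by (rule finite_imageD) (auto intro: inj_onI simp: poly_mapping.lookup_inject)
qed

lemma lookup_e_tilde:
  assumes "finite S"
  shows "Poly_Mapping.lookup (e_tilde d S) m = (if m \<in> monomials_of_degree d S then 1 else 0)"
  unfolding e_tilde_def monomials_of_degree_def[symmetric]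
  using finite_monomials_of_degree[OF assms]
  by (simp add: lookup_sum lookup_single when_def)

lemma keys_e_tilde: "finite S \<Longrightarrow> Poly_Mapping.keys (e_tilde d S) = monomials_of_degree d S"
  by (auto simp: in_keys_iff lookup_e_tilde split: if_splits)

lemma indets_e_tilde: "finite S \<Longrightarrow> indets (e_tilde d S) \<subseteq> S"
  by (auto simp: indets_def keys_e_tilde monomials_of_degree_def)

context monomial_order
begin

lemma monomial_le_power_of_greatest_variable:
  assumes "\<And>j. j \<in> S \<Longrightarrow> Poly_Mapping.single j 1 \<preceq> Poly_Mapping.single i 1"
    and "m \<in> monomials_of_degree d S"
  shows "m \<preceq> Poly_Mapping.single i d"
  using assms(2)
proof (induction d arbitrary: m)
  case 0
  then show ?case by (simp add: monomials_of_degree_def total_degree_eq_0_iff)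
next
  case (Suc d)
  then have "m \<noteq> 0" using total_degree_eq_0_iff[of m] by (simp add: monomials_of_degree_def)
  then obtain j where j: "j \<in> Poly_Mapping.keys m"
    by (metis all_not_in_conv keys_eq_empty)
  let ?m = "m - Poly_Mapping.single j 1"
  have m_eq: "m = ?m + Poly_Mapping.single j 1"
    using monomial_diff_add_cancel[OF monomial_dvd_single_in_keys[OF j]] by simp
  then have "total_degree m = total_degree ?m + 1"
    by (metis total_degree_add total_degree_single)
  then have "?m \<in> monomials_of_degree d S"
    using Suc.prems keys_monomial_diff by (fastforce simp: monomials_of_degree_def)
  then have "?m \<preceq> Poly_Mapping.single i d" by (rule Suc.IH)
  moreover have "Poly_Mapping.single j 1 \<preceq> Poly_Mapping.single i 1"
    using Suc.prems j by (intro assms(1)) (auto simp: monomials_of_degree_def)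
  ultimately have "m \<preceq> Poly_Mapping.single i d + Poly_Mapping.single i 1"
    by (subst (1 2) m_eq) (rule add_mono)
  then show ?case by (simp add: single_add[symmetric])
qed

lemma
  assumes "finite S" "i \<in> S" "\<And>j. j \<in> S \<Longrightarrow> Poly_Mapping.single j 1 \<preceq> Poly_Mapping.single i 1"
  shows leading_monomial_e_tilde: "lm (e_tilde d S) = Poly_Mapping.single i d"
    and monic_e_tilde: "monic (e_tilde d S)"
proof -
  have power_mem: "Poly_Mapping.single i d \<in> monomials_of_degree d S"
    using assms(2) by (simp add: monomials_of_degree_def)
  then show lm: "lm (e_tilde d S) = Poly_Mapping.single i d"
    using assms(1) monomial_le_power_of_greatest_variable[OF assms(3)]
    by (intro leading_monomial_eqI) (simp_all add: keys_e_tilde)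
  show "monic (e_tilde d S)" using power_mem assms(1) by (simp add: lc_def lm lookup_e_tilde)
qed

theorem groebner_basis_J_generators:
  assumes "\<And>i j. i < j \<Longrightarrow> Poly_Mapping.single j 1 \<prec> Poly_Mapping.single i 1"
  shows "groebner_basis n (\<prec>) (J_generators n h) (J_ideal n h)"
proof -
  have variable_le: "Poly_Mapping.single j 1 \<preceq> Poly_Mapping.single i 1" if "j \<in> {i..n}" for i j
    using that assms[of i j] by (cases "i = j") auto
  have leading: "lm (e_tilde d {i..n}) = Poly_Mapping.single i d" "monic (e_tilde d {i..n})"
    if "i \<in> {1..n}" for i d
    using that variable_le by (intro leading_monomial_e_tilde monic_e_tilde[of _ i]; simp)+
  have "J_generators n h = (\<lambda>i. e_tilde (degree_tuple n h i) {i..n}) ` {1..n}"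
    by (auto simp: J_generators_def)
  moreover have "e_tilde d {i..n} \<in> carrier (int_mpoly_ring n)" if "i \<in> {1..n}" for i d
    using that indets_e_tilde[of "{i..n}" d] by (fastforce simp: carrier_int_mpoly_ring)
  ultimately show ?thesis
    unfolding J_ideal_def
    by (intro groebner_basis_if_coprime) (auto simp: leading pairwise_def monomial_coprime_def)
qed

end

section \<open>The lexicographic orders\<close>

lemma lex_less_eq_less: "lex_less = (<)"
  by (intro ext) (auto simp: lex_less_def less_poly_mapping.rep_eq less_fun_def)

lemma lex_less_single: "i < j \<Longrightarrow> lex_less (Poly_Mapping.single j 1) (Poly_Mapping.single i 1)"
  unfolding lex_less_def by (intro exI[of _ i]) (simp add: lookup_single when_def)

definition exponents :: "nat \<Rightarrow> monomial \<Rightarrow> nat list" where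
  "exponents n m = map (Poly_Mapping.lookup m) [0..<n]"

lemma lex_less_imp_exponents_lex:
  assumes "lex_less a b" "Poly_Mapping.keys b \<subseteq> {..<n}"
  shows "(exponents n a, exponents n b) \<in> lex less_than"
proof -
  obtain i where i: "Poly_Mapping.lookup a i < Poly_Mapping.lookup b i"
    "\<And>j. j < i \<Longrightarrow> Poly_Mapping.lookup b j = Poly_Mapping.lookup a j"
    using assms(1) by (auto simp: lex_less_def)
  then have "i < n" using assms(2) by (auto simp: in_keys_iff subset_iff)
  then have "exponents n m = exponents i m @ Poly_Mapping.lookup m i #
      map (Poly_Mapping.lookup m) [Suc i..<n]" for m
    using upt_add_eq_append[of 0 i "n - i"] by (simp add: exponents_def upt_conv_Cons)
  moreover have "exponents i a = exponents i b" using i(2) by (simp add: exponents_def)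
  ultimately show ?thesis
    using i(1) by (auto simp: lex_append_left_iff)
qed

lemma wfp_on_if_convertible_to_wf:
  assumes "wf r" "\<And>a b. a \<in> A \<Longrightarrow> b \<in> A \<Longrightarrow> R a b \<Longrightarrow> (f a, f b) \<in> r"
  shows "wfp_on A R"
proof (rule wfp_on_if_convertible_to_wfp_on)
  show "wfp_on (f ` A) (\<lambda>x y. (x, y) \<in> r)"
    using assms(1) by (auto simp: wfp_on_wf_on_eq intro: wf_on_subset)
qed (use assms(2) in simp)

lemma
  assumes "finite S"
  shows wfp_on_lex_less: "wfp_on {m. Poly_Mapping.keys m \<subseteq> S} lex_less"
    and wfp_on_grlex_less: "wfp_on {m. Poly_Mapping.keys m \<subseteq> S} grlex_less"
proof -
  obtain n where "S \<subseteq> {..<n}"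
    using assms by (auto simp: finite_nat_set_iff_bounded)
  then have lex: "(exponents n a, exponents n b) \<in> lex less_than"
    if "lex_less a b" "Poly_Mapping.keys b \<subseteq> S" for a b
    using that by (intro lex_less_imp_exponents_lex) auto
  show "wfp_on {m. Poly_Mapping.keys m \<subseteq> S} lex_less"
    by (rule wfp_on_if_convertible_to_wf[of "lex less_than" _ _ "exponents n"]) (use lex in auto)
  show "wfp_on {m. Poly_Mapping.keys m \<subseteq> S} grlex_less"
    by (rule wfp_on_if_convertible_to_wf[of "less_than <*lex*> lex less_than" _ _
          "\<lambda>m. (total_degree m, exponents n m)"])
      (use lex in \<open>auto simp: grlex_less_def\<close>)
qed

interpretation lex: monomial_order lex_less
  by unfold_locales (auto simp: lex_less_eq_less add_strict_right_mono
      wfp_on_lex_less[unfolded lex_less_eq_less])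

interpretation grlex: monomial_order grlex_less
proof
  show "transp grlex_less"
    by (rule transpI) (auto simp: grlex_less_def lex_less_eq_less)
  show "totalp grlex_less"
    by (rule totalpI) (auto simp: grlex_less_def lex_less_eq_less)
qed (auto simp: grlex_less_def lex_less_eq_less total_degree_add add_strict_right_mono
    intro: wfp_on_grlex_less)

theorem theorem5p7:
  fixes n :: nat and h :: "nat \<Rightarrow> nat"
  assumes "hessenberg n h"
  shows "groebner_basis n lex_less (J_generators n h) (J_ideal n h)
       \<and> groebner_basis n grlex_less (J_generators n h) (J_ideal n h)"
proof
  show "groebner_basis n lex_less (J_generators n h) (J_ideal n h)"
    by (rule lex.groebner_basis_J_generators) (rule lex_less_single)
  show "groebner_basis n grlex_less (J_generators n h) (J_ideal n h)"
    by (rule grlex.groebner_basis_J_generators)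
      (simp only: grlex_less_def total_degree_single lex_less_single simp_thms)
qed

end
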